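(* Let $m$, $q$ and $t$ be positive integers such that $q$ is a prime power, $m \geq 2q+2$ and $2 \leq t < mq^{t-1}$. Then $C(v,mq^{t-1},t) = q\left(\frac{q^t-1}{q-1}\right)$ for each integer $v$ such that \[mq^t-q+1-z \leq v \leq mq^t, \quad\mbox{ where }\quad z=\min\left(q-2,\ \left\lfloor \frac{m(q-1)q^{t-1}}{q^t - 1}\right\rfloor - 2q + 1\right).\]
   Context: For positive integers $t,v,k$ with $t \leq k \leq v$, a $t$-$(v,k,1)$ covering is a pair $(V,\mathcal{B})$ where $V$ is a set of $v$ points and $\mathcal{B}$ is a multiset of $k$-subsets of $V$ (called blocks) such that each $t$-subset of $V$ is contained in at least one block in $\mathcal{B}$. The covering number $C(v,k,t)$ is the minimum number of blocks (counted with multiplicity) in any $t$-$(v,k,1)$ covering. A prime power is an integer $p^n$ with $p$ prime and $n\ge 1$. *)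

theory Defs
  imports Complex_Main "HOL-Library.Multiset" "HOL-Number_Theory.Prime_Powers"
begin

definition covering :: "nat \<Rightarrow> nat \<Rightarrow> nat \<Rightarrow> 'a set \<Rightarrow> 'a set multiset \<Rightarrow> bool" where
  "covering t v k V \<B> \<longleftrightarrow>
     0 < t \<and> t \<le> k \<and> k \<le> v \<and>
     finite V \<and> card V = v \<and>
     (\<forall>B \<in># \<B>. B \<subseteq> V \<and> card B = k) \<and>
     (\<forall>T. T \<subseteq> V \<and> card T = t \<longrightarrow> (\<exists>B \<in># \<B>. T \<subseteq> B))"

text \<open>The points are taken to be natural numbers; the lemmas below show that the minimum
  exists and that it is a lower bound for coverings with points of an arbitrary type.\<close>

definition covering_number :: "nat \<Rightarrow> nat \<Rightarrow> nat \<Rightarrow> nat" where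
  "covering_number v k t = (LEAST b. \<exists>(V :: nat set) \<B>. covering t v k V \<B> \<and> size \<B> = b)"

lemma covering_exists:
  assumes "0 < t" "t \<le> k" "k \<le> v"
  shows "\<exists>(V :: nat set) \<B>. covering t v k V \<B>"
proof -
  let ?V = "{..<v}"
  let ?S = "{B. B \<subseteq> ?V \<and> card B = k}"
  have fin: "finite ?S" by simp
  have "\<exists>B \<in># mset_set ?S. T \<subseteq> B" if T: "T \<subseteq> ?V" "card T = t" for T
  proof -
    obtain B where "T \<subseteq> B" "B \<subseteq> ?V" "card B = k"
      using exists_subset_between[of T k ?V] T assms by auto
    then show ?thesis using fin by auto
  qed
  then have "covering t v k ?V (mset_set ?S)"
    using assms fin unfolding covering_def by auto
  then show ?thesis by blast
qed

lemma covering_number_attained: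
  assumes "0 < t" "t \<le> k" "k \<le> v"
  shows "\<exists>(V :: nat set) \<B>. covering t v k V \<B> \<and> size \<B> = covering_number v k t"
  unfolding covering_number_def
  by (rule LeastI_ex) (use covering_exists[OF assms] in blast)

lemma covering_number_le:
  fixes V :: "'a set"
  assumes "covering t v k V \<B>"
  shows "covering_number v k t \<le> size \<B>"
proof -
  have fin: "finite V" and cV: "card V = v"
    and blocks: "\<And>B. B \<in># \<B> \<Longrightarrow> B \<subseteq> V \<and> card B = k"
    and cov: "\<And>T. T \<subseteq> V \<Longrightarrow> card T = t \<Longrightarrow> \<exists>B \<in># \<B>. T \<subseteq> B"
    and pars: "0 < t" "t \<le> k" "k \<le> v"
    using assms unfolding covering_def by auto
  obtain f :: "'a \<Rightarrow> nat" where inj: "inj_on f V"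
    using finite_imp_inj_to_nat_seg[OF fin] by blast
  let ?\<B> = "image_mset (\<lambda>B. f ` B) \<B>"
  have "\<exists>B \<in># ?\<B>. T \<subseteq> B" if T: "T \<subseteq> f ` V" "card T = t" for T
  proof -
    obtain U where U: "U \<subseteq> V" "T = f ` U"
      using T(1) by (meson subset_imageE)
    have "card U = t"
      using U T(2) card_image[OF inj_on_subset[OF inj U(1)]] by simp
    then obtain B where "B \<in># \<B>" "U \<subseteq> B" using cov U(1) by blast
    then show ?thesis using U(2) by auto
  qed
  moreover have "B \<subseteq> f ` V \<and> card B = k" if "B \<in># ?\<B>" for B
    using that blocks card_image inj_on_subset[OF inj] by fastforce
  moreover have "card (f ` V) = v" using card_image[OF inj] cV by simp
  ultimately have "covering t v k (f ` V) ?\<B>"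
    using pars fin unfolding covering_def by blast
  moreover have "size ?\<B> = size \<B>" by simp
  ultimately show ?thesis
    unfolding covering_number_def by (intro Least_le) blast
qed

end

theory Submission
  imports "HOL-Algebra.Algebraic_Closure" "HOL-Number_Theory.Residues" Defs
begin

text \<open>
  Write \<open>k = m q^(t-1)\<close> and \<open>N(j) = 1 + q + \<dots> + q^(j-1)\<close>, so that the claim is
  \<open>C(v, k, t) = q N(t)\<close>.

  Upper bound. The affine space of dimension \<open>t\<close> over the field with \<open>q\<close> elements has \<open>q^t\<close>
  points and \<open>q N(t)\<close> hyperplanes of \<open>q^(t-1)\<close> points each, and any \<open>t\<close> points lie on a
  hyperplane. Replacing every point by \<open>m\<close> copies gives a covering on \<open>m q^t\<close> points with blocks
  of size \<open>k\<close>; it can be restricted to any \<open>v \<le> m q^t\<close> of the points, enlarging the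
  blocks again to size \<open>k\<close>. This is \<open>covering_number_le_hyperplanes\<close>. The field itself is
  obtained in \<open>finite_field_exists\<close> as the set of fixed points of the \<open>q\<close>-th power map in an
  algebraic closure of the integers modulo \<open>p\<close>.

  Lower bound. The blocks through \<open>j\<close> given points, with these points deleted, form a
  \<open>(t-j)\<close>-covering with parameters \<open>v - j\<close> and \<open>k - j\<close>. Counting incidences repeatedly
  (Schoenheim's argument, \<open>covering_family_size_ge\<close>) shows that a \<open>j\<close>-covering with more than
  \<open>q\<close> times as many points as the block size has at least \<open>N(j+1)\<close> blocks. When \<open>v\<close> lies at
  most \<open>2q - 3\<close> below \<open>qk\<close> this applies after two points are deleted, so every pair of
  points lies in at least \<open>\<lambda> = N(t-1)\<close> blocks. Continuing to count in the same way would
  lose a block at the next level: a point may lie in only \<open>r = q\<lambda>\<close> blocks, whereas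
  \<open>r + 1 = N(t)\<close> are wanted. But if it does, the pairs at that point are covered only
  slightly more often than \<open>\<lambda>\<close> times on the whole, and Bose's proof of Fisher's
  inequality, in the form given to it by Horsley, shows that the incidence vectors of such points
  are linearly independent. Hence there are at most \<open>b\<close> of them among \<open>b\<close> blocks, and counting incidences once more gives
  \<open>v (r + 1) \<le> b (k + 1)\<close> (\<open>pair_covering_size_bound\<close>,
  \<open>t_covering_size_bound\<close>). If \<open>b\<close> were at most \<open>q N(t) - 1\<close>, this would force
  \<open>k + 1 \<le> (qk - v + q) N(t)\<close>, which the second term in the definition of \<open>z\<close> excludes;
  the first term, \<open>q - 2\<close>, is what keeps \<open>v\<close> within \<open>2q - 3\<close> of \<open>qk\<close>.
\<close>

section \<open>Counting in coverings\<close>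

text \<open>Blocks are indexed rather than collected in a multiset, so that the blocks through a point
  form a subset of the index set and double counting is an exchange of finite sums. The case
  \<open>t = 0\<close> is included as the base of the induction on the strength.\<close>

definition covering_family :: "nat \<Rightarrow> nat \<Rightarrow> 'a set \<Rightarrow> 'i set \<Rightarrow> ('i \<Rightarrow> 'a set) \<Rightarrow> bool" where
  "covering_family t k V I B \<longleftrightarrow>
     finite V \<and> finite I \<and> (\<forall>i\<in>I. B i \<subseteq> V \<and> card (B i) = k) \<and>
     (\<forall>T. T \<subseteq> V \<and> card T = t \<longrightarrow> (\<exists>i\<in>I. T \<subseteq> B i))"

lemma covering_imp_covering_family:
  assumes "covering t v k V \<B>"
  obtains B where "covering_family t k V {..<size \<B>} B"
proof -
  obtain xs where xs: "mset xs = \<B>" using ex_mset by blast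
  have "covering_family t k V {..<size \<B>} ((!) xs)"
    using assms unfolding covering_def covering_family_def xs[symmetric]
    by (simp add: Ball_def) (metis in_set_conv_nth lessThan_iff)
  then show thesis by (rule that)
qed

lemma covering_family_derived:
  assumes "covering_family (Suc t) k V I B" "x \<in> V"
  shows "covering_family t (k - 1) (V - {x}) {i \<in> I. x \<in> B i} (\<lambda>i. B i - {x})"
proof -
  have *: "\<exists>i\<in>{i \<in> I. x \<in> B i}. T \<subseteq> B i - {x}" if "T \<subseteq> V - {x}" "card T = t" for T
  proof -
    have "finite T" using assms that unfolding covering_family_def by (meson finite_Diff finite_subset)
    moreover have "x \<notin> T" using that by blast
    ultimately have "insert x T \<subseteq> V" "card (insert x T) = Suc t"
      using that assms(2) by auto
    then obtain i where "i \<in> I" "insert x T \<subseteq> B i"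
      using assms(1) unfolding covering_family_def by blast
    then show ?thesis using that by auto
  qed
  show ?thesis
    using assms * unfolding covering_family_def by auto
qed

lemma sum_card_eq_sum_degrees:
  assumes "finite V" "finite I" "\<And>i. i \<in> I \<Longrightarrow> B i \<subseteq> V"
  shows "(\<Sum>i\<in>I. card (B i)) = (\<Sum>x\<in>V. card {i \<in> I. x \<in> B i})"
proof -
  have "(\<Sum>i\<in>I. card (B i)) = (\<Sum>i\<in>I. \<Sum>x\<in>V. if x \<in> B i then 1 else 0)"
  proof (rule sum.cong[OF refl])
    fix i assume "i \<in> I"
    then have "B i = {x\<in>V. x \<in> B i}" using assms(3) by auto
    then show "card (B i) = (\<Sum>x\<in>V. if x \<in> B i then 1 else 0)"
      using assms(1) by (simp add: sum.If_cases Int_def)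
  qed
  also have "\<dots> = (\<Sum>x\<in>V. \<Sum>i\<in>I. if x \<in> B i then 1 else 0)" by (rule sum.swap)
  also have "\<dots> = (\<Sum>x\<in>V. card {i \<in> I. x \<in> B i})"
    using assms(2) by (simp add: sum.If_cases Int_def)
  finally show ?thesis .
qed

text \<open>In the step from \<open>t\<close> to \<open>t + 1\<close>, each point lies in at least
  \<open>N = 1 + \<dots> + q^t\<close> blocks by induction applied to the derived covering, so the number \<open>b\<close> of blocks satisfies \<open>b k \<ge> |V| N > q k N\<close> and
  therefore \<open>b \<ge> q N + 1\<close>. The hypothesis \<open>q k < |V|\<close> passes to derived coverings because
  deleting a point lowers \<open>|V|\<close> by 1 but \<open>q k\<close> by \<open>q \<ge> 1\<close>.\<close>

lemma covering_family_size_ge: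
  assumes "covering_family t k V I B" "t \<le> k" "q * k < card V" "0 < q"
  shows "(\<Sum>i<Suc t. q ^ i) \<le> card I"
  using assms(1-3)
proof (induction t arbitrary: k V I B)
  case 0
  then have "I \<noteq> {}" "finite I" unfolding covering_family_def by (auto dest: spec[of _ "{}"])
  then show ?case by (simp add: Suc_le_eq card_gt_0_iff)
next
  case (Suc t)
  let ?N = "\<Sum>i<Suc t. q ^ i"
  have fin: "finite V" "finite I" and B: "\<And>i. i \<in> I \<Longrightarrow> B i \<subseteq> V" "\<And>i. i \<in> I \<Longrightarrow> card (B i) = k"
    using Suc.prems unfolding covering_family_def by auto
  have deg: "?N \<le> card {i \<in> I. x \<in> B i}" if "x \<in> V" for x
  proof (rule Suc.IH[OF covering_family_derived[OF Suc.prems(1) that]])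
    show "t \<le> k - 1" using Suc.prems by simp
    have "q * (k - 1) + q = q * k" using Suc.prems(2) by (cases k) auto
    then show "q * (k - 1) < card (V - {x})"
      using Suc.prems(3) \<open>0 < q\<close> that fin by simp
  qed
  have "q * ?N * k < card V * ?N"
  proof -
    have "0 < ?N" by (simp add: sum.lessThan_Suc_shift del: sum.lessThan_Suc)
    then have "(q * k) * ?N < card V * ?N" using Suc.prems(3) by (rule mult_strict_right_mono[rotated])
    then show ?thesis by (simp only: ac_simps)
  qed
  also have "\<dots> \<le> (\<Sum>x\<in>V. card {i \<in> I. x \<in> B i})"
    using sum_mono[of V "\<lambda>_. ?N", OF deg] by simp
  also have "\<dots> = card I * k"
    using sum_card_eq_sum_degrees[OF fin B(1)] B(2) fin by simp
  finally have "q * ?N < card I" by simp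
  moreover have "(\<Sum>i<Suc (Suc t). q ^ i) = Suc (q * ?N)"
    by (subst sum.lessThan_Suc_shift) (simp add: sum_distrib_left del: sum.lessThan_Suc)
  ultimately show ?case by simp
qed

section \<open>The Fisher-type bound\<close>

text \<open>Gaussian elimination: an equation with a nonzero coefficient at the unknown \<open>p\<close> is solved
  for \<open>p\<close> and substituted into the others, which leaves a system with one equation and one
  unknown fewer.\<close>

lemma homogeneous_system_nontrivial_solution:
  fixes a :: "'e \<Rightarrow> 'j \<Rightarrow> 'f::field"
  assumes "finite E" "finite J" "card E < card J"
  shows "\<exists>y. (\<exists>x\<in>J. y x \<noteq> 0) \<and> (\<forall>e\<in>E. (\<Sum>x\<in>J. a e x * y x) = 0)"
  using assms
proof (induction E arbitrary: J a rule: finite_induct)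
  case empty
  then have "J \<noteq> {}" by auto
  then show ?case by (intro exI[of _ "\<lambda>_. 1"]) auto
next
  case (insert e E)
  show ?case
  proof (cases "\<forall>x\<in>J. a e x = 0")
    case True
    have "card E < card J" using insert by simp
    from insert.IH[OF insert.prems(1) this, of a] True show ?thesis by auto
  next
    case False
    then obtain p where p: "p \<in> J" "a e p \<noteq> 0" by blast
    let ?b = "\<lambda>f x. a f x - a f p * a e x / a e p"
    have "card E < card (J - {p})" using insert p by simp
    from insert.IH[OF _ this, of ?b] insert.prems(1)
    obtain y where y: "\<exists>x\<in>J - {p}. y x \<noteq> 0" "\<And>f. f \<in> E \<Longrightarrow> (\<Sum>x\<in>J - {p}. ?b f x * y x) = 0"
      by auto
    define s where "s = (\<Sum>x\<in>J - {p}. a e x * y x)"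
    let ?y = "y(p := - s / a e p)"
    have split: "(\<Sum>x\<in>J. a f x * ?y x) = (\<Sum>x\<in>J - {p}. a f x * y x) - a f p * s / a e p" for f
    proof -
      have "(\<Sum>x\<in>J. a f x * ?y x) = a f p * ?y p + (\<Sum>x\<in>J - {p}. a f x * ?y x)"
        using insert.prems(1) p(1) by (rule sum.remove)
      also have "(\<Sum>x\<in>J - {p}. a f x * ?y x) = (\<Sum>x\<in>J - {p}. a f x * y x)"
        by (rule sum.cong) auto
      finally show ?thesis by simp
    qed
    have "(\<Sum>x\<in>J - {p}. a f x * y x) = a f p * s / a e p" if "f \<in> E" for f
      using y(2)[OF that]
      by (simp add: s_def left_diff_distrib sum_subtractf sum_distrib_left sum_divide_distrib mult.assoc)
    then have "(\<Sum>x\<in>J. a f x * ?y x) = 0" if "f \<in> insert e E" for f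
      using that p(2) by (auto simp only: split) (simp_all add: s_def)
    moreover have "\<exists>x\<in>J. ?y x \<noteq> 0" using y(1) by auto
    ultimately show ?thesis by blast
  qed
qed

text \<open>
  The pairs at a point of degree \<open>r\<close> are covered \<open>D = r (k - 1) - lam (v - 1)\<close> times in excess
  of the required \<open>lam\<close> times each, and the second hypothesis on \<open>r\<close> says that
  \<open>D < r - lam\<close>. On the points of degree \<open>r\<close> the Gram matrix of the incidence vectors is
  therefore \<open>lam\<close> times the all-ones matrix plus a strictly diagonally dominant matrix, hence
  positive definite, so at most \<open>b = card I\<close> points have degree \<open>r\<close>. The same inequality with
  \<open>r < k + lam\<close> excludes degrees below \<open>r\<close>, so that
  \<open>b k \<ge> (r + 1) v - b\<close> by counting incidences.
\<close>

lemma pair_covering_size_bound: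
  fixes r lam v k :: nat
  assumes fin: "finite V" "finite I" and B: "\<And>i. i \<in> I \<Longrightarrow> B i \<subseteq> V" "\<And>i. i \<in> I \<Longrightarrow> card (B i) = k"
    and "card V = v" "0 < k"
    and pairs: "\<And>x y. x \<in> V \<Longrightarrow> y \<in> V \<Longrightarrow> x \<noteq> y \<Longrightarrow> lam \<le> card {i \<in> I. x \<in> B i \<and> y \<in> B i}"
    and r: "r < k + lam" "r * k + 2 * lam < lam * v + 2 * r"
  shows "v * (r + 1) \<le> card I * (k + 1)"
proof -
  define deg where "deg x = card {i \<in> I. x \<in> B i}" for x
  define cod where "cod x y = card {i \<in> I. x \<in> B i \<and> y \<in> B i}" for x y
  have cod_sum: "(\<Sum>y\<in>V - {x}. cod x y) = deg x * (k - 1)" if "x \<in> V" for x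
  proof -
    have "(\<Sum>i\<in>{i \<in> I. x \<in> B i}. card (B i - {x})) = (\<Sum>y\<in>V - {x}. card {i \<in> {i \<in> I. x \<in> B i}. y \<in> B i - {x}})"
      by (rule sum_card_eq_sum_degrees) (use fin B in auto)
    moreover have "card (B i - {x}) = k - 1" if "i \<in> {i \<in> I. x \<in> B i}" for i
      using that B by auto
    moreover have "card {i \<in> {i \<in> I. x \<in> B i}. y \<in> B i - {x}} = cod x y" if "y \<in> V - {x}" for y
      unfolding cod_def by (rule arg_cong[where f=card]) (use that in auto)
    ultimately show ?thesis by (simp add: deg_def)
  qed
  have cod_int: "(\<Sum>y\<in>V - {x}. int (cod x y) - int lam) = int (deg x) * (int k - 1) - int lam * (int v - 1)"
    if "x \<in> V" for x
  proof -
    have "int (deg x * (k - 1)) = int (deg x) * (int k - 1)"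
      using \<open>0 < k\<close> by (simp add: of_nat_diff)
    moreover have "card V \<noteq> 0" using that fin by auto
    ultimately show ?thesis
      using cod_sum[OF that, THEN arg_cong[where f=int]] that fin \<open>card V = v\<close>
      by (simp add: sum_subtractf of_nat_diff)
  qed
  have deg_ge: "r \<le> deg x" if "x \<in> V" for x
  proof (rule ccontr)
    assume "\<not> r \<le> deg x"
    have "0 \<le> (\<Sum>y\<in>V - {x}. int (cod x y) - int lam)"
      using pairs[OF that] by (intro sum_nonneg) (auto simp: cod_def)
    then have 1: "int lam * (int v - 1) \<le> int (deg x) * (int k - 1)" using cod_int[OF that] by simp
    show False
    proof -
      have "int (deg x) * (int k - 1) \<le> (int r - 1) * (int k - 1)"
        using \<open>0 < k\<close> \<open>\<not> r \<le> deg x\<close> by (intro mult_right_mono) auto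
      then have "int lam * (int v - 1) \<le> (int r - 1) * (int k - 1)" using 1 by simp
      moreover have "int r * int k + 2 * int lam < int lam * int v + 2 * int r"
        using r(2) by (metis (mono_tags) of_nat_add of_nat_less_iff of_nat_mult of_nat_numeral)
      ultimately show False using r(1) by (simp add: algebra_simps)
    qed
  qed
  define W where "W = {x \<in> V. deg x = r}"
  have finW: "finite W" and WV: "W \<subseteq> V" using fin by (auto simp: W_def)
  have W_le: "card W \<le> card I"
  proof (rule ccontr)
    assume "\<not> card W \<le> card I"
    then obtain y :: "'a \<Rightarrow> real" where y: "\<exists>x\<in>W. y x \<noteq> 0"
      and y0: "\<And>i. i \<in> I \<Longrightarrow> (\<Sum>x\<in>W. of_bool (x \<in> B i) * y x) = 0"
      using homogeneous_system_nontrivial_solution[OF fin(2) finW, of "\<lambda>i x. of_bool (x \<in> B i)"] by auto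
    define c where "c u w = real (card {i \<in> I. u \<in> B i \<and> w \<in> B i})" for u w
    have c: "c u w = (\<Sum>i\<in>I. of_bool (u \<in> B i) * of_bool (w \<in> B i))" for u w
      using fin(2) by (simp add: c_def flip: of_bool_conj) (simp add: of_bool_def sum.If_cases Int_def)
    \<comment> \<open>The quadratic form of the Gram matrix is the sum over the blocks of the squares of the
      linear forms that \<open>y\<close> annihilates.\<close>
    have quad: "(\<Sum>u\<in>W. \<Sum>w\<in>W. c u w * (y u * y w)) = 0"
    proof -
      have "(\<Sum>u\<in>W. \<Sum>w\<in>W. c u w * (y u * y w))
          = (\<Sum>u\<in>W. \<Sum>w\<in>W. \<Sum>i\<in>I. (of_bool (u \<in> B i) * y u) * (of_bool (w \<in> B i) * y w))"
        unfolding c sum_distrib_right by (simp add: mult_ac)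
      also have "\<dots> = (\<Sum>u\<in>W. \<Sum>i\<in>I. \<Sum>w\<in>W. (of_bool (u \<in> B i) * y u) * (of_bool (w \<in> B i) * y w))"
        by (rule sum.cong[OF refl]) (rule sum.swap)
      also have "\<dots> = 0" by (simp add: y0 flip: sum_distrib_left)
      finally show ?thesis .
    qed
    define e where "e u w = c u w - real lam" for u w
    have e_nonneg: "0 \<le> e u w" if "u \<in> W" "w \<in> W" "u \<noteq> w" for u w
      using pairs[of u w] that WV by (auto simp: e_def c_def)
    define D where "D = real r * (real k - 1) - real lam * (real v - 1)"
    have D: "D < real r - real lam"
    proof -
      have "real r * real k + 2 * real lam < real lam * real v + 2 * real r"
        using r(2) by (metis (mono_tags) of_nat_add of_nat_less_iff of_nat_mult of_nat_numeral)
      then show ?thesis by (simp add: D_def algebra_simps)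
    qed
    have e_sum: "(\<Sum>w\<in>W - {u}. e u w) \<le> D" if "u \<in> W" for u
    proof -
      have "(\<Sum>w\<in>W - {u}. e u w) \<le> (\<Sum>w\<in>V - {u}. e u w)"
        using fin WV that pairs by (intro sum_mono2) (auto simp: e_def c_def)
      also have "\<dots> = real_of_int (\<Sum>w\<in>V - {u}. int (cod u w) - int lam)"
        by (simp add: e_def c_def cod_def)
      also have "\<dots> = D"
        using that unfolding W_def by (subst cod_int) (auto simp: D_def)
      finally show ?thesis .
    qed
    define S where "S = (\<Sum>u\<in>W. (y u)\<^sup>2)"
    have "0 < S"
    proof -
      obtain x where "x \<in> W" "y x \<noteq> 0" using y by blast
      then show ?thesis unfolding S_def using finW by (intro sum_pos2[of W x]) auto
    qed
    have sym: "e u w = e w u" for u w by (simp add: e_def c_def conj_commute)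
    let ?P = "\<Sum>u\<in>W. \<Sum>w\<in>W - {u}. e u w * (y u)\<^sup>2"
    have P_le: "?P \<le> D * S"
    proof -
      have "?P = (\<Sum>u\<in>W. (\<Sum>w\<in>W - {u}. e u w) * (y u)\<^sup>2)" by (simp add: sum_distrib_right)
      also have "\<dots> \<le> (\<Sum>u\<in>W. D * (y u)\<^sup>2)" by (intro sum_mono mult_right_mono e_sum) auto
      finally show ?thesis by (simp add: S_def sum_distrib_left)
    qed
    \<comment> \<open>Diagonal dominance: each mixed term is bounded by
      \<open>0 \<le> (y u + y w)^2\<close>, and by symmetry both squares contribute the same total.\<close>
    have P_sym: "(\<Sum>u\<in>W. \<Sum>w\<in>W - {u}. e u w * (y w)\<^sup>2) = ?P"
    proof -
      have "(\<Sum>u\<in>W. \<Sum>w\<in>W - {u}. e u w * (y w)\<^sup>2) = (\<Sum>u\<in>W. \<Sum>w\<in>{w\<in>W. w \<noteq> u}. e u w * (y w)\<^sup>2)"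
        by (intro sum.cong refl) auto
      also have "\<dots> = (\<Sum>w\<in>W. \<Sum>u\<in>{u\<in>W. w \<noteq> u}. e u w * (y w)\<^sup>2)"
        using finW by (rule sum.swap_restrict) (rule finW)
      also have "\<dots> = ?P"
      proof (intro sum.cong refl)
        show "{u \<in> W. w \<noteq> u} = W - {w}" for w by auto
      qed (rule arg_cong2[where f="(*)"], rule sym, rule refl)
      finally show ?thesis .
    qed
    have "0 = (\<Sum>u\<in>W. \<Sum>w\<in>W. real lam * (y u * y w)) + (\<Sum>u\<in>W. \<Sum>w\<in>W. e u w * (y u * y w))"
    proof -
      have "c u w * (y u * y w) = real lam * (y u * y w) + e u w * (y u * y w)" for u w
        by (simp add: e_def algebra_simps)
      then show ?thesis using quad by (simp only: sum.distrib)
    qed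
    also have "(\<Sum>u\<in>W. \<Sum>w\<in>W. real lam * (y u * y w)) = real lam * (\<Sum>u\<in>W. y u)\<^sup>2"
      by (simp only: power2_eq_square sum_product) (simp only: sum_distrib_left)
    also have "(\<Sum>u\<in>W. \<Sum>w\<in>W. e u w * (y u * y w))
        = (real r - real lam) * S + (\<Sum>u\<in>W. \<Sum>w\<in>W - {u}. e u w * (y u * y w))"
    proof -
      have "(\<Sum>w\<in>W. e u w * (y u * y w)) = (real r - real lam) * (y u)\<^sup>2 + (\<Sum>w\<in>W - {u}. e u w * (y u * y w))"
        if "u \<in> W" for u
        using sum.remove[OF finW that, of "\<lambda>w. e u w * (y u * y w)"] that
        by (simp add: e_def c_def W_def deg_def power2_eq_square)
      then show ?thesis by (simp add: sum.distrib S_def sum_distrib_left)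
    qed
    finally have total: "0 = real lam * (\<Sum>u\<in>W. y u)\<^sup>2
        + ((real r - real lam) * S + (\<Sum>u\<in>W. \<Sum>w\<in>W - {u}. e u w * (y u * y w)))" .
    have cross: "(\<Sum>u\<in>W. \<Sum>w\<in>W - {u}. e u w * (y u * y w)) \<ge> - ?P"
    proof -
      have "0 \<le> (\<Sum>u\<in>W. \<Sum>w\<in>W - {u}. e u w * (y u + y w)\<^sup>2)"
        by (intro sum_nonneg mult_nonneg_nonneg e_nonneg) auto
      also have "\<dots> = ?P + (\<Sum>u\<in>W. \<Sum>w\<in>W - {u}. e u w * (y w)\<^sup>2)
          + 2 * (\<Sum>u\<in>W. \<Sum>w\<in>W - {u}. e u w * (y u * y w))"
      proof -
        have "e u w * (y u + y w)\<^sup>2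
            = e u w * (y u)\<^sup>2 + e u w * (y w)\<^sup>2 + 2 * (e u w * (y u * y w))" for u w
          by (simp add: power2_sum algebra_simps)
        then show ?thesis by (simp only: sum.distrib sum_distrib_left)
      qed
      finally show ?thesis using P_sym by simp
    qed
    have "0 \<le> real lam * (\<Sum>u\<in>W. y u)\<^sup>2" by simp
    then have "(real r - real lam) * S - ?P \<le> 0" using total cross by linarith
    then have "(real r - real lam - D) * S \<le> 0" using P_le by (simp add: algebra_simps)
    moreover have "0 < (real r - real lam - D) * S" using D \<open>0 < S\<close> by simp
    ultimately show False by simp
  qed
  have "v * (r + 1) \<le> (\<Sum>x\<in>V. deg x + of_bool (x \<in> W))"
  proof -
    have "r + 1 \<le> deg x + of_bool (x \<in> W)" if "x \<in> V" for x
      using deg_ge[OF that] that by (auto simp: W_def)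
    from sum_mono[of V "\<lambda>_. r + 1", OF this] show ?thesis using \<open>card V = v\<close> by simp
  qed
  also have "\<dots> = card I * k + card W"
    using sum_card_eq_sum_degrees[OF fin B(1)] B(2) fin WV
    by (simp add: sum.distrib deg_def of_bool_def sum.If_cases Int_absorb1)
  also have "\<dots> \<le> card I * (k + 1)" using W_le by simp
  finally show ?thesis .
qed

section \<open>Finite fields of prime power order\<close>

lemma (in cring) binomial_theorem:
  assumes x: "x \<in> carrier R" and y: "y \<in> carrier R"
  shows "(x \<oplus> y) [^] (n::nat) = (\<Oplus>k\<in>{..n}. [(n choose k)] \<cdot> (x [^] k \<otimes> y [^] (n - k)))"
proof (induction n)
  case 0
  then show ?case using x y by simp
next
  case (Suc n)
  let ?b = "\<lambda>k. [(n choose k)] \<cdot> (x [^] k \<otimes> y [^] (n - k))"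
  let ?m = "\<lambda>k. x [^] k \<otimes> y [^] (Suc n - k)"
  \<comment> \<open>The two halves of Pascal's rule, padded by zero at opposite ends to range over the same
    exponents.\<close>
  let ?f = "\<lambda>k. case k of 0 \<Rightarrow> \<zero> | Suc j \<Rightarrow> [(n choose j)] \<cdot> ?m k"
  let ?g = "\<lambda>k. [(n choose k)] \<cdot> ?m k"
  have m: "?m k \<in> carrier R" for k using x y by simp
  have f: "?f \<in> A \<rightarrow> carrier R" for A using x y by (auto split: nat.splits)
  have g: "?g \<in> A \<rightarrow> carrier R" for A using m by auto
  have "(x \<oplus> y) [^] Suc n = (\<Oplus>k\<in>{..n}. ?b k) \<otimes> x \<oplus> (\<Oplus>k\<in>{..n}. ?b k) \<otimes> y"
    using x y Suc by (simp add: r_distr)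
  also have "(\<Oplus>k\<in>{..n}. ?b k) \<otimes> x = (\<Oplus>k\<in>{..n}. ?f (Suc k))"
  proof -
    have "?b k \<otimes> x = ?f (Suc k)" for k
      using x y by (simp add: add_pow_ldistr add_pow_rdistr m_ac)
    then show ?thesis using x y by (simp add: finsum_ldistr)
  qed
  also have "(\<Oplus>k\<in>{..n}. ?f (Suc k)) = (\<Oplus>k\<in>{..Suc n}. ?f k)"
  proof -
    have "(\<lambda>k. ?f (Suc k)) \<in> {..n} \<rightarrow> carrier R" using x y by auto
    from finsum_closed[OF this] show ?thesis
      by (subst finsum_Suc2[OF f]) (simp only: nat.case r_zero)
  qed
  also have "(\<Oplus>k\<in>{..n}. ?b k) \<otimes> y = (\<Oplus>k\<in>{..n}. ?g k)"
  proof -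
    have "?b k \<otimes> y = ?g k" if "k \<le> n" for k
      using x y that by (simp add: add_pow_ldistr m_assoc Suc_diff_le)
    then show ?thesis using x y g by (simp add: finsum_ldistr) (intro finsum_cong', auto)
  qed
  also have "(\<Oplus>k\<in>{..n}. ?g k) = (\<Oplus>k\<in>{..Suc n}. ?g k)"
    using finsum_closed[OF g[of "{..n}"]] x y by (subst finsum_Suc[OF g]) (simp add: binomial_eq_0)
  also have "(\<Oplus>k\<in>{..Suc n}. ?f k) \<oplus> (\<Oplus>k\<in>{..Suc n}. ?g k) = (\<Oplus>k\<in>{..Suc n}. ?f k \<oplus> ?g k)"
    by (rule finsum_addf[symmetric, OF f g])
  also have "\<dots> = (\<Oplus>k\<in>{..Suc n}. [(Suc n choose k)] \<cdot> ?m k)"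
  proof (rule finsum_cong')
    show "?f k \<oplus> ?g k = [(Suc n choose k)] \<cdot> ?m k" for k
      using m[of k] by (cases k) (simp_all add: add.nat_pow_mult)
  qed (use m in auto)
  finally show ?case .
qed

lemma (in cring) freshmans_dream:
  assumes p: "prime (p::nat)" "[p] \<cdot> \<one> = \<zero>" and x: "x \<in> carrier R" and y: "y \<in> carrier R"
  shows "(x \<oplus> y) [^] p = x [^] p \<oplus> y [^] p"
proof -
  let ?b = "\<lambda>k. [(p choose k)] \<cdot> (x [^] k \<otimes> y [^] (p - k))"
  have b: "?b \<in> A \<rightarrow> carrier R" for A using x y by auto
  have zero: "[p] \<cdot> z = \<zero>" if "z \<in> carrier R" for z
    using add_pow_ldistr[of \<one> z p] p that by simp
  obtain n where n: "p = Suc (Suc n)"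
    using prime_ge_2_nat[OF p(1)] by (metis add_2_eq_Suc le_Suc_ex)
  have mid: "?b k = \<zero>" if k: "0 < k" "k < p" for k
  proof -
    have "p dvd (p choose k)" using p k by (intro dvd_choose_prime) auto
    then obtain c where "p choose k = p * c" by blast
    then show ?thesis using x y zero by (simp add: add.nat_pow_pow[symmetric])
  qed
  have "(x \<oplus> y) [^] p = (\<Oplus>k\<in>{..p}. ?b k)" by (rule binomial_theorem[OF x y])
  also have "\<dots> = (\<Oplus>k\<in>{..Suc (Suc n)}. ?b k)" by (simp only: n)
  also have "\<dots> = ?b (Suc (Suc n)) \<oplus> ((\<Oplus>k\<in>{..n}. ?b (Suc k)) \<oplus> ?b 0)"
    using b finsum_Suc[of ?b "Suc n"] finsum_Suc2[of ?b n] by simp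
  also have "(\<Oplus>k\<in>{..n}. ?b (Suc k)) = \<zero>"
  proof (rule add.finprod_one_eqI)
    show "?b (Suc k) = \<zero>" if "k \<in> {..n}" for k by (rule mid) (use n that in auto)
  qed
  finally show ?thesis using x y n by simp
qed

lemma (in cring) freshmans_dream_power:
  assumes p: "prime (p::nat)" "[p] \<cdot> \<one> = \<zero>" and x: "x \<in> carrier R" and y: "y \<in> carrier R"
  shows "(x \<oplus> y) [^] (p ^ n) = x [^] (p ^ n) \<oplus> y [^] (p ^ n)"
proof (induction n)
  case (Suc n)
  then show ?case using x y freshmans_dream[OF p]
    by (simp add: nat_pow_pow[symmetric] mult.commute[of p] del: nat_pow_pow)
qed (use x y in simp)

lemma ring_hom_multiple_of_one:
  assumes "h \<in> ring_hom R S" "ring R" "ring S"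
  shows "h ([(n::nat)] \<cdot>\<^bsub>R\<^esub> \<one>\<^bsub>R\<^esub>) = [n] \<cdot>\<^bsub>S\<^esub> \<one>\<^bsub>S\<^esub>"
proof -
  interpret R: ring R by fact
  interpret S: ring S by fact
  show ?thesis
    by (induction n)
      (use assms in \<open>simp_all add: ring_hom_zero[OF assms] ring_hom_add ring_hom_one\<close>)
qed

text \<open>
  The fixed points are the roots of \<open>f = X^q - X\<close>, which splits, so it suffices that all roots
  are simple. If \<open>a^q = a\<close> and \<open>u = X - a\<close>, then \<open>X^q = u^q + a\<close> by the freshman's dream in
  the polynomial ring, so \<open>f = u^q - u = u (u^(q-1) - 1)\<close>, and the second factor takes the value
  \<open>-1\<close> at \<open>a\<close>. This avoids formal derivatives.
\<close>

lemma (in algebraically_closed) card_frobenius_fixed_points: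
  assumes p: "prime (p::nat)" "[p] \<cdot> \<one> = \<zero>" and "0 < n"
  shows "card {x \<in> carrier L. x [^] (p ^ n) = x} = p ^ n"
proof -
  define q where "q = p ^ n"
  have q: "1 < q" using prime_gt_1_nat[OF p(1)] \<open>0 < n\<close> unfolding q_def by (rule one_less_power)
  note sub = carrier_is_subring
  let ?P = "poly_ring L"
  interpret UP: domain ?P by (rule univ_poly_is_domain[OF sub])
  have var: "X \<in> carrier ?P" by (rule var_closed(1)[OF sub])
  define f where "f = X [^]\<^bsub>?P\<^esub> q \<ominus>\<^bsub>?P\<^esub> X"
  have f: "f \<in> carrier ?P" unfolding f_def using var by simp
  have char: "[p] \<cdot>\<^bsub>?P\<^esub> \<one>\<^bsub>?P\<^esub> = \<zero>\<^bsub>?P\<^esub>"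
  proof -
    have h: "poly_of_const \<in> ring_hom L ?P" using canonical_embedding_is_hom[OF sub] by simp
    show ?thesis
      using ring_hom_multiple_of_one[OF h ring_axioms UP.ring_axioms, of p]
        ring_hom_zero[OF h ring_axioms UP.ring_axioms] p(2) by simp
  qed
  have deg: "degree f = q"
  proof -
    have "degree (X [^]\<^bsub>?P\<^esub> q) = q" using polynomial_pow_degree[OF var, of q] by (simp add: var_def)
    moreover have "degree (\<ominus>\<^bsub>?P\<^esub> X) = 1"
      using univ_poly_a_inv_degree[OF sub var] by (simp add: var_def)
    moreover have "polynomial (carrier L) (X [^]\<^bsub>?P\<^esub> q)" "polynomial (carrier L) (\<ominus>\<^bsub>?P\<^esub> X)"
      using var by (simp_all only: univ_poly_carrier UP.nat_pow_closed UP.a_inv_closed)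
    ultimately show ?thesis
      using q poly_add_degree_eq[OF sub, of "X [^]\<^bsub>?P\<^esub> q" "\<ominus>\<^bsub>?P\<^esub> X"]
      unfolding f_def a_minus_def univ_poly_add by linarith
  qed
  then have f0: "f \<noteq> []" using q by auto
  have eval_f: "eval f x = x [^] q \<ominus> x" if x: "x \<in> carrier L" for x
  proof -
    interpret E: ring_hom_ring ?P L "\<lambda>p. eval p x" by (rule eval_ring_hom[OF sub x])
    show ?thesis using x var by (simp add: f_def a_minus_def E.hom_nat_pow eval_var)
  qed
  have roots_f: "x \<in># roots f \<longleftrightarrow> x \<in> carrier L \<and> x [^] q = x" for x
    using eval_f f0 by (auto simp: roots_mem_iff_is_root[OF f] is_root_def)
  have "alg_mult f a < 2" if a: "a \<in> carrier L" "a [^] q = a" for a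
  proof (rule ccontr)
    assume "\<not> alg_mult f a < 2"
    define u where "u = [\<one>, \<ominus> a]"
    have u: "u \<in> carrier ?P" using a by (simp add: u_def sym[OF univ_poly_carrier] polynomial_def)
    interpret E: ring_hom_ring ?P L "\<lambda>p. eval p a" by (rule eval_ring_hom[OF sub a(1)])
    have "(u [^]\<^bsub>?P\<^esub> (2::nat)) pdivides f"
      using le_alg_mult_imp_pdivides[OF a(1) f, of 2] \<open>\<not> alg_mult f a < 2\<close> by (simp add: u_def)
    then obtain w where w: "w \<in> carrier ?P" "f = u [^]\<^bsub>?P\<^esub> (2::nat) \<otimes>\<^bsub>?P\<^esub> w"
      unfolding pdivides_def by auto
    define c where "c = poly_of_const a"
    have c: "c \<in> carrier ?P" "c [^]\<^bsub>?P\<^esub> q = c"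
    proof -
      interpret C: ring_hom_ring L ?P poly_of_const
        using canonical_embedding_ring_hom[OF sub] by simp
      show "c \<in> carrier ?P" "c [^]\<^bsub>?P\<^esub> q = c" using a C.hom_nat_pow[of a q] by (simp_all add: c_def)
    qed
    have X: "X = u \<oplus>\<^bsub>?P\<^esub> c"
      using a by (auto simp: u_def c_def var_def univ_poly_add poly_of_const_def l_neg)
    have "f = (u [^]\<^bsub>?P\<^esub> q \<oplus>\<^bsub>?P\<^esub> c) \<ominus>\<^bsub>?P\<^esub> (u \<oplus>\<^bsub>?P\<^esub> c)"
      unfolding f_def X using UP.freshmans_dream_power[OF p(1) char u c(1), of n] c(2) by (simp add: q_def)
    also have "\<dots> = u [^]\<^bsub>?P\<^esub> q \<ominus>\<^bsub>?P\<^esub> u"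
      using u c(1) UP.nat_pow_closed[OF u, of q] by (simp add: UP.minus_add a_minus_def UP.a_ac UP.r_neg2)
    also have "u [^]\<^bsub>?P\<^esub> q = u \<otimes>\<^bsub>?P\<^esub> u [^]\<^bsub>?P\<^esub> (q - 1)"
      using UP.nat_pow_Suc2[OF u, of "q - 1"] q by simp
    finally have "u \<otimes>\<^bsub>?P\<^esub> (u \<otimes>\<^bsub>?P\<^esub> w) = u \<otimes>\<^bsub>?P\<^esub> (u [^]\<^bsub>?P\<^esub> (q - 1) \<ominus>\<^bsub>?P\<^esub> \<one>\<^bsub>?P\<^esub>)"
      using w u by (simp add: numeral_2_eq_2 UP.m_assoc a_minus_def UP.r_distr UP.r_minus)
    moreover have "u \<noteq> \<zero>\<^bsub>?P\<^esub>" by (simp add: u_def univ_poly_zero)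
    ultimately have "u \<otimes>\<^bsub>?P\<^esub> w = u [^]\<^bsub>?P\<^esub> (q - 1) \<ominus>\<^bsub>?P\<^esub> \<one>\<^bsub>?P\<^esub>"
      using UP.m_lcancel[of u] u w by simp
    then have "eval (u \<otimes>\<^bsub>?P\<^esub> w) a = eval (u [^]\<^bsub>?P\<^esub> (q - 1) \<ominus>\<^bsub>?P\<^esub> \<one>\<^bsub>?P\<^esub>) a" by simp
    moreover have eu: "eval u a = \<zero>" using a by (simp add: u_def r_neg)
    ultimately have "\<zero> = \<zero> [^] (q - 1) \<ominus> \<one>"
      using u w by (simp add: a_minus_def E.hom_nat_pow)
    then have "\<zero> = \<ominus> \<one>" using q by (simp add: nat_pow_zero a_minus_def)
    then show False using one_not_zero by (metis add.inv_inv minus_zero one_closed)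
  qed
  then have "count (roots f) a = 1" if "a \<in># roots f" for a
    using that roots_f[of a] alg_mult_eq_count_roots[OF f] count_greater_zero_iff[of "roots f" a]
    by (metis One_nat_def less_2_cases less_numeral_extra(3))
  then have "card (set_mset (roots f)) = size (roots f)"
    by (simp add: size_multiset_overloaded_eq)
  also have "\<dots> = q"
    using roots_over_carrier[OF f] deg by (simp add: splitted_def)
  also have "set_mset (roots f) = {x \<in> carrier L. x [^] q = x}"
    using roots_f by auto
  finally show ?thesis by (simp add: q_def)
qed

lemma (in algebraically_closed) frobenius_fixed_points_subfield:
  assumes p: "prime (p::nat)" "[p] \<cdot> \<one> = \<zero>"
  shows "subfield {x \<in> carrier L. x [^] (p ^ n) = x} L"
proof (rule subfieldI'[OF subringI])
  let ?F = "{x \<in> carrier L. x [^] (p ^ n) = x}"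
  show "\<one> \<in> ?F" by simp
  have q: "p ^ n \<noteq> 0" using p(1) by (simp add: prime_gt_0_nat)
  show "\<ominus> x \<in> ?F" if "x \<in> ?F" for x
  proof -
    have "(x \<oplus> \<ominus> x) [^] (p ^ n) = \<zero>" using that q by (simp add: r_neg nat_pow_zero)
    then have "x \<oplus> (\<ominus> x) [^] (p ^ n) = \<zero>"
      using that freshmans_dream_power[OF p, of x "\<ominus> x" n] by simp
    then have "\<ominus> x = (\<ominus> x) [^] (p ^ n)"
      using that by (intro minus_equality) (auto simp: a_comm)
    then show ?thesis using that by simp
  qed
  show "inv x \<in> ?F" if "x \<in> ?F - {\<zero>}" for x
  proof -
    have x: "x \<in> carrier L" "x \<noteq> \<zero>" "x [^] (p ^ n) = x" using that by auto
    then have inv: "inv x \<in> carrier L" "x \<otimes> inv x = \<one>" by (simp_all add: field_Units)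
    then have "x \<otimes> inv x [^] (p ^ n) = \<one>"
      using x nat_pow_distrib[of x "inv x" "p ^ n"] by simp
    then have "inv x [^] (p ^ n) = inv x"
      using x inv m_lcancel[of x "inv x [^] (p ^ n)" "inv x"] by simp
    then show ?thesis using inv by simp
  qed
qed (use freshmans_dream_power[OF p] in \<open>auto simp: nat_pow_distrib\<close>)

text \<open>The type of the field is that of the algebraic closure of the integers modulo \<open>p\<close>.\<close>

lemma finite_field_exists:
  assumes "prime (p::nat)" "0 < n"
  obtains F :: "(((int list \<times> nat) multiset) \<Rightarrow> int) ring"
  where "field F" "card (carrier F) = p ^ n"
proof -
  interpret Zp: residues_prime p "residue_ring (int p)" using assms(1) by unfold_locales auto
  let ?L = "Zp.alg_closure"
  interpret L: algebraic_closure ?L "Zp.indexed_const ` carrier (residue_ring (int p))"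
    by (rule Zp.alg_closureE)
  have multiple: "[k] \<cdot>\<^bsub>residue_ring (int p)\<^esub> \<one>\<^bsub>residue_ring (int p)\<^esub> = int k mod int p" for k :: nat
    by (induction k) (simp_all add: Zp.res_zero_eq Zp.res_one_eq Zp.res_add_eq mod_add_right_eq add.commute)
  have "[p] \<cdot>\<^bsub>?L\<^esub> \<one>\<^bsub>?L\<^esub> = \<zero>\<^bsub>?L\<^esub>"
    using ring_hom_multiple_of_one[OF Zp.alg_closureE(2) Zp.ring_axioms L.ring_axioms, of p]
      ring_hom_zero[OF Zp.alg_closureE(2) Zp.ring_axioms L.ring_axioms] multiple[of p]
    by (simp add: Zp.res_zero_eq)
  then show thesis
    using L.card_frobenius_fixed_points[OF assms(1) _ assms(2)]
      L.subfield_iff(2)[OF L.frobenius_fixed_points_subfield[OF assms(1), of n]]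
    by (intro that[of "?L\<lparr>carrier := {x \<in> carrier ?L. x [^]\<^bsub>?L\<^esub> (p ^ n) = x}\<rparr>"]) auto
qed

section \<open>Covering affine space by hyperplanes\<close>

text \<open>For \<open>a = 0\<close> this is everything or empty; the lemmas below ask for a nonzero coordinate of
  \<open>a\<close>.\<close>

definition (in field) hyperplane :: "nat \<Rightarrow> (nat \<Rightarrow> 'a) \<Rightarrow> 'a \<Rightarrow> (nat \<Rightarrow> 'a) set" where
  "hyperplane t a c = {x \<in> {..<t} \<rightarrow>\<^sub>E carrier R. (\<Oplus>i\<in>{..<t}. a i \<otimes> x i) = c}"

text \<open>A coordinate at which \<open>a\<close> does not vanish is determined by the others.\<close>

lemma (in field) card_hyperplane_le:
  assumes fin: "finite (carrier R)" and a: "a \<in> {..<t} \<rightarrow> carrier R" and j: "j < t" "a j \<noteq> \<zero>"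
  shows "card (hyperplane t a c) \<le> card (carrier R) ^ (t - 1)"
proof -
  let ?J = "{..<t} - {j}"
  have split: "(\<Oplus>i\<in>{..<t}. a i \<otimes> x i) = a j \<otimes> x j \<oplus> (\<Oplus>i\<in>?J. a i \<otimes> x i)"
    if "x \<in> {..<t} \<rightarrow>\<^sub>E carrier R" for x
  proof -
    have "(\<lambda>i. a i \<otimes> x i) \<in> ?J \<rightarrow> carrier R" "a j \<otimes> x j \<in> carrier R"
      using a that j(1) by (auto simp: PiE_iff Pi_iff)
    then show ?thesis
      using finsum_insert[of ?J j "\<lambda>i. a i \<otimes> x i"] j(1) by (simp add: insert_absorb)
  qed
  have "inj_on (\<lambda>x. restrict x ?J) (hyperplane t a c)"
  proof (rule inj_onI)
    fix x y assume xy: "x \<in> hyperplane t a c" "y \<in> hyperplane t a c" and eq: "restrict x ?J = restrict y ?J"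
    have x: "x \<in> {..<t} \<rightarrow>\<^sub>E carrier R" and y: "y \<in> {..<t} \<rightarrow>\<^sub>E carrier R"
      using xy by (auto simp: hyperplane_def)
    have off: "x i = y i" if "i \<in> ?J" for i using fun_cong[OF eq, of i] that by simp
    have carr: "a i \<otimes> x i \<in> carrier R" "a i \<otimes> y i \<in> carrier R" if "i < t" for i
      using a x y that by (auto simp: PiE_iff Pi_iff)
    have rest: "(\<Oplus>i\<in>?J. a i \<otimes> x i) = (\<Oplus>i\<in>?J. a i \<otimes> y i)"
      using off carr by (intro finsum_cong') auto
    have "(\<Oplus>i\<in>{..<t}. a i \<otimes> x i) = (\<Oplus>i\<in>{..<t}. a i \<otimes> y i)"
      using xy by (simp add: hyperplane_def)
    then have "a j \<otimes> x j \<oplus> (\<Oplus>i\<in>?J. a i \<otimes> y i) = a j \<otimes> y j \<oplus> (\<Oplus>i\<in>?J. a i \<otimes> y i)"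
      using split[OF x] split[OF y] rest by simp
    moreover have "(\<Oplus>i\<in>?J. a i \<otimes> y i) \<in> carrier R" using carr by (intro finsum_closed) auto
    ultimately have "a j \<otimes> x j = a j \<otimes> y j" using carr[OF j(1)] by simp
    then have "x j = y j"
      using m_lcancel[of "a j" "x j" "y j"] j a x y by (auto simp: PiE_iff Pi_iff)
    then show "x = y"
      using off x y by (intro PiE_ext[OF x y]) (metis DiffI singletonD)
  qed
  moreover have "(\<lambda>x. restrict x ?J) ` hyperplane t a c \<subseteq> ?J \<rightarrow>\<^sub>E carrier R"
    by (auto simp: hyperplane_def PiE_iff split: if_splits)
  moreover have "finite (?J \<rightarrow>\<^sub>E carrier R)" using fin by (simp add: finite_PiE)
  ultimately have "card (hyperplane t a c) \<le> card (?J \<rightarrow>\<^sub>E carrier R)"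
    by (rule card_inj_on_le)
  also have "\<dots> = card (carrier R) ^ (t - 1)"
    using j(1) by (simp add: card_PiE)
  finally show ?thesis .
qed

text \<open>
  There are \<open>q^(t+1)\<close> pairs \<open>(a, c)\<close> but at most \<open>q^t\<close> possibilities for the values of
  \<open>x \<mapsto> a \<cdot> x - c\<close> on \<open>S\<close>. Two pairs that agree on \<open>S\<close> have as their difference an
  equation satisfied by all of \<open>S\<close>. If its coefficients all vanished, so would its constant term,
  since \<open>S\<close> is nonempty.
\<close>

lemma (in field) points_in_hyperplane:
  assumes fin: "finite (carrier R)" and S: "S \<subseteq> {..<t} \<rightarrow>\<^sub>E carrier R" "card S \<le> t" "S \<noteq> {}"
  shows "\<exists>a\<in>{..<t} \<rightarrow>\<^sub>E carrier R. \<exists>c\<in>carrier R. (\<exists>j<t. a j \<noteq> \<zero>) \<and> S \<subseteq> hyperplane t a c"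
proof -
  let ?V = "{..<t} \<rightarrow>\<^sub>E carrier R" and ?q = "card (carrier R)"
  define dot where "dot a x = (\<Oplus>i\<in>{..<t}. a i \<otimes> x i)" for a x :: "nat \<Rightarrow> 'a"
  have dot: "dot a x \<in> carrier R" if "a \<in> ?V" "x \<in> ?V" for a x
    using that unfolding dot_def by (intro finsum_closed) (auto simp: PiE_iff)
  have "finite ?V" using fin by (simp add: finite_PiE)
  then have finS: "finite S" using S(1) finite_subset by blast
  let ?g = "\<lambda>(a, c). \<lambda>x\<in>S. dot a x \<ominus> c"
  have "1 < ?q"
  proof -
    have "card {\<zero>, \<one>} \<le> ?q" using fin by (intro card_mono) auto
    then show ?thesis by simp
  qed
  have "\<not> inj_on ?g (?V \<times> carrier R)"
  proof
    assume inj: "inj_on ?g (?V \<times> carrier R)"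
    have "?g ` (?V \<times> carrier R) \<subseteq> S \<rightarrow>\<^sub>E carrier R" using dot S(1) by auto
    from card_inj_on_le[OF inj this] have "?q ^ t * ?q \<le> ?q ^ card S"
      using fin finS by (simp add: finite_PiE card_PiE card_cartesian_product)
    also have "\<dots> \<le> ?q ^ t" using S(2) \<open>1 < ?q\<close> by (simp add: power_increasing)
    finally show False using \<open>1 < ?q\<close> by simp
  qed
  then obtain a c b d where ab: "a \<in> ?V" "b \<in> ?V" "c \<in> carrier R" "d \<in> carrier R"
    and ne: "(a, c) \<noteq> (b, d)" and eq: "?g (a, c) = ?g (b, d)"
    unfolding inj_on_def by blast
  have eq': "dot a x \<ominus> c = dot b x \<ominus> d" if "x \<in> S" for x
    using fun_cong[OF eq, of x] that by simp
  define e where "e = (\<lambda>i\<in>{..<t}. a i \<ominus> b i)"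
  have e: "e \<in> ?V" using ab by (auto simp: e_def PiE_iff)
  have dot_e: "dot e x = dot a x \<ominus> dot b x" if x: "x \<in> ?V" for x
  proof -
    have carr: "a i \<in> carrier R" "b i \<in> carrier R" "x i \<in> carrier R" "e i \<in> carrier R" if "i < t" for i
      using that ab x e by (auto simp: PiE_iff)
    have "dot e x \<oplus> dot b x = (\<Oplus>i\<in>{..<t}. e i \<otimes> x i \<oplus> b i \<otimes> x i)"
      unfolding dot_def using carr by (intro finsum_addf[symmetric]) auto
    also have "\<dots> = dot a x" unfolding dot_def
    proof (rule finsum_cong')
      show "e i \<otimes> x i \<oplus> b i \<otimes> x i = a i \<otimes> x i" if "i \<in> {..<t}" for i
      proof -
        have "e i \<otimes> x i \<oplus> b i \<otimes> x i = (e i \<oplus> b i) \<otimes> x i" using carr that by (simp add: l_distr)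
        also have "e i \<oplus> b i = a i" using carr[of i] that by (simp add: e_def a_minus_def a_assoc l_neg)
        finally show ?thesis .
      qed
    qed (use carr in auto)
    finally have "dot a x = dot e x \<oplus> dot b x" by simp
    then show ?thesis using dot[OF e x] dot[OF ab(2) x] by (simp add: a_minus_def a_assoc r_neg)
  qed
  have "S \<subseteq> hyperplane t e (c \<ominus> d)"
  proof
    fix x assume "x \<in> S"
    then have x: "x \<in> ?V" using S(1) by blast
    have A: "dot a x \<in> carrier R" and B: "dot b x \<in> carrier R" using dot ab x by auto
    have "dot e x = (dot a x \<ominus> c) \<ominus> (dot b x \<ominus> d) \<oplus> (c \<ominus> d)"
      unfolding dot_e[OF x] using A B ab(3,4) by algebra
    also have "\<dots> = c \<ominus> d" unfolding eq'[OF \<open>x \<in> S\<close>] using B ab(3,4) by algebra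
    finally show "x \<in> hyperplane t e (c \<ominus> d)" using x by (simp add: hyperplane_def dot_def)
  qed
  moreover have "\<exists>j<t. e j \<noteq> \<zero>"
  proof (rule ccontr)
    assume "\<not> (\<exists>j<t. e j \<noteq> \<zero>)"
    then have e0: "a i = b i" if "i < t" for i
      using that ab by (auto simp: e_def PiE_iff)
    then have "a = b" using ab by (intro PiE_ext[OF ab(1,2)]) auto
    moreover obtain x where "x \<in> S" using S(3) by blast
    moreover have B: "dot b x \<in> carrier R" using dot[OF ab(2), of x] S(1) \<open>x \<in> S\<close> by blast
    ultimately have "\<ominus> c = \<ominus> d"
      using eq'[of x] add.l_cancel[of "dot b x" "\<ominus> c" "\<ominus> d"] B ab(3,4) by (simp add: a_minus_def)
    then have "c = d" using ab(3,4) minus_minus by metis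
    then show False using ne \<open>a = b\<close> by simp
  qed
  ultimately show ?thesis using e ab(3,4) by blast
qed

text \<open>The hyperplanes are counted by their equations: there are \<open>(q^t - 1) q\<close> equations with
  nonzero coefficient vector, and each hyperplane has at least \<open>q - 1\<close> of them, the nonzero
  multiples of any one.\<close>

lemma (in field) hyperplane_cover_exists:
  fixes t :: nat
  assumes fin: "finite (carrier R)"
  defines "q \<equiv> card (carrier R)" and "V \<equiv> {..<t} \<rightarrow>\<^sub>E carrier R"
  obtains \<H> where "finite \<H>" "card \<H> * (q - 1) \<le> q * (q ^ t - 1)"
    "\<And>H. H \<in> \<H> \<Longrightarrow> H \<subseteq> V \<and> card H \<le> q ^ (t - 1)"
    "\<And>S. S \<subseteq> V \<Longrightarrow> S \<noteq> {} \<Longrightarrow> card S \<le> t \<Longrightarrow> \<exists>H\<in>\<H>. S \<subseteq> H"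
proof -
  define N where "N = {a \<in> V. \<exists>j<t. a j \<noteq> \<zero>}"
  define A where "A = N \<times> carrier R"
  define h where "h = (\<lambda>(a, c). hyperplane t a c)"
  have finV: "finite V" using fin by (simp add: V_def finite_PiE)
  have cV: "card V = q ^ t" by (simp add: V_def q_def card_PiE)
  have z: "(\<lambda>i\<in>{..<t}. \<zero>) \<in> V" by (simp add: V_def)
  have "N = V - {\<lambda>i\<in>{..<t}. \<zero>}"
  proof -
    have "a = (\<lambda>i\<in>{..<t}. \<zero>) \<longleftrightarrow> (\<forall>j<t. a j = \<zero>)" if "a \<in> V" for a
    proof
      assume "\<forall>j<t. a j = \<zero>"
      then show "a = (\<lambda>i\<in>{..<t}. \<zero>)"
        using PiE_ext[of a "{..<t}" "\<lambda>_. carrier R" "\<lambda>i\<in>{..<t}. \<zero>"] that z by (simp add: V_def)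
    qed simp
    then show ?thesis unfolding N_def by auto
  qed
  then have "card N = q ^ t - 1" using z finV cV by simp
  then have cA: "card A = q * (q ^ t - 1)" by (simp add: A_def q_def card_cartesian_product)
  have finA: "finite A" using finV fin by (simp add: A_def N_def)
  have fibre: "q - 1 \<le> card {z \<in> A. h z = H}" if H: "H \<in> h ` A" for H
  proof -
    obtain a c where ac: "a \<in> V" "c \<in> carrier R" "H = hyperplane t a c" "\<exists>j<t. a j \<noteq> \<zero>"
      using H by (auto simp: A_def N_def h_def)
    then obtain j where j: "j < t" "a j \<noteq> \<zero>" by blast
    have a: "a i \<in> carrier R" if "i < t" for i using ac(1) that by (auto simp: V_def)
    define scale where "scale u = ((\<lambda>i\<in>{..<t}. u \<otimes> a i), u \<otimes> c)" for u
    have "scale ` (carrier R - {\<zero>}) \<subseteq> {z \<in> A. h z = H}"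
    proof (rule image_subsetI)
      fix u assume "u \<in> carrier R - {\<zero>}"
      then have u: "u \<in> carrier R" "u \<noteq> \<zero>" by auto
      have "(\<lambda>i\<in>{..<t}. u \<otimes> a i) \<in> N"
        using u a j integral[of u "a j"] by (auto simp: N_def V_def intro!: exI[of _ j])
      then have "scale u \<in> A" using u ac(2) by (simp add: scale_def A_def)
      moreover have "hyperplane t (\<lambda>i\<in>{..<t}. u \<otimes> a i) (u \<otimes> c) = H"
      proof -
        have "(\<Oplus>i\<in>{..<t}. (\<lambda>i\<in>{..<t}. u \<otimes> a i) i \<otimes> x i) = u \<otimes> c \<longleftrightarrow> (\<Oplus>i\<in>{..<t}. a i \<otimes> x i) = c"
          if "x \<in> V" for x
        proof -
          have x: "x i \<in> carrier R" if "i < t" for i using \<open>x \<in> V\<close> that by (auto simp: V_def)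
          have "(\<Oplus>i\<in>{..<t}. (\<lambda>i\<in>{..<t}. u \<otimes> a i) i \<otimes> x i) = (\<Oplus>i\<in>{..<t}. u \<otimes> (a i \<otimes> x i))"
            using u a x by (intro finsum_cong') (auto simp: m_assoc)
          also have "\<dots> = u \<otimes> (\<Oplus>i\<in>{..<t}. a i \<otimes> x i)"
            using u a x by (intro finsum_rdistr[symmetric]) auto
          finally show ?thesis
            using m_lcancel[of u "\<Oplus>i\<in>{..<t}. a i \<otimes> x i" c] u a x ac(2) by (auto intro!: finsum_closed)
        qed
        then show ?thesis unfolding ac(3) hyperplane_def V_def by blast
      qed
      ultimately show "scale u \<in> {z \<in> A. h z = H}" by (simp add: h_def scale_def)
    qed
    moreover have "inj_on scale (carrier R - {\<zero>})"
    proof (rule inj_onI)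
      fix u w assume uw: "u \<in> carrier R - {\<zero>}" "w \<in> carrier R - {\<zero>}" "scale u = scale w"
      then have "u \<otimes> a j = w \<otimes> a j" using j(1) by (auto simp: scale_def dest: fun_cong[of _ _ j])
      then show "u = w" using m_rcancel[of "a j" u w] uw a j by auto
    qed
    ultimately have "card (carrier R - {\<zero>}) \<le> card {z \<in> A. h z = H}"
      using finA by (intro card_inj_on_le) auto
    then show ?thesis by (simp add: q_def)
  qed
  have "card (h ` A) * (q - 1) \<le> (\<Sum>H\<in>h ` A. card {z \<in> A. h z = H})"
    using sum_mono[of "h ` A" "\<lambda>_. q - 1", OF fibre] by simp
  also have "\<dots> = card A"
    using sum.image_gen[OF finA, of "\<lambda>_. 1 :: nat" h] by simp
  finally have "card (h ` A) * (q - 1) \<le> q * (q ^ t - 1)" by (simp add: cA)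
  moreover have "H \<subseteq> V \<and> card H \<le> q ^ (t - 1)" if "H \<in> h ` A" for H
  proof -
    obtain a c j where "a \<in> V" "H = hyperplane t a c" "j < t" "a j \<noteq> \<zero>"
      using \<open>H \<in> h ` A\<close> by (auto simp: A_def N_def h_def)
    moreover from this have "a \<in> {..<t} \<rightarrow> carrier R" by (auto simp: V_def)
    ultimately show ?thesis
      using card_hyperplane_le[OF fin, of a t j c] by (auto simp: q_def V_def hyperplane_def)
  qed
  moreover have "\<exists>H\<in>h ` A. S \<subseteq> H" if S: "S \<subseteq> V" "S \<noteq> {}" "card S \<le> t" for S
  proof -
    from points_in_hyperplane[OF fin, of S t] S obtain a c
      where "a \<in> V" "c \<in> carrier R" "\<exists>j<t. a j \<noteq> \<zero>" "S \<subseteq> hyperplane t a c"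
      unfolding V_def by auto
    then show ?thesis by (intro bexI[of _ "h (a, c)"]) (auto simp: h_def A_def N_def)
  qed
  ultimately show thesis using that[of "h ` A"] finA by blast
qed

section \<open>The covering number\<close>

text \<open>The case \<open>r = q lam\<close> of the Fisher-type bound, with the pair multiplicity \<open>lam\<close> supplied by
  the covering derived at two points. For this \<open>r\<close> both that derivation and the condition
  \<open>D < r - lam\<close> amount to \<open>qk - v < 2 (q - 1)\<close>.\<close>

lemma t_covering_size_bound:
  assumes cov: "covering t v k V \<B>" and t: "2 \<le> t" and q: "2 \<le> q"
    and lam: "lam = (\<Sum>i<t - 1. q ^ i)"
    and v: "q * k + 2 < v + 2 * q" and k: "q * lam < k + lam"
  shows "v * (q * lam + 1) \<le> size \<B> * (k + 1)"
proof -
  obtain B where B: "covering_family t k V {..<size \<B>} B"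
    using covering_imp_covering_family[OF cov] .
  let ?I = "{..<size \<B>}"
  have tk: "t \<le> k" and cV: "card V = v" using cov by (auto simp: covering_def)
  obtain s where s: "t = Suc (Suc s)" using t by (metis add_2_eq_Suc le_Suc_ex)
  have "v * (q * lam + 1) \<le> card ?I * (k + 1)"
  proof (rule pair_covering_size_bound[where B = B and V = V and lam = lam])
    show "finite V" "finite ?I" "\<And>i. i \<in> ?I \<Longrightarrow> B i \<subseteq> V" "\<And>i. i \<in> ?I \<Longrightarrow> card (B i) = k"
      using B by (auto simp: covering_family_def)
    show "card V = v" "0 < k" "q * lam < k + lam" using cV tk t k by auto
    have "0 < lam" unfolding lam s by (simp add: sum.lessThan_Suc_shift del: sum.lessThan_Suc)
    then have "(q * k + 2) * lam < (v + 2 * q) * lam" using v by (rule mult_strict_right_mono[rotated])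
    then show "q * lam * k + 2 * lam < lam * v + 2 * (q * lam)" by (simp add: algebra_simps)
    show "lam \<le> card {i \<in> ?I. x \<in> B i \<and> y \<in> B i}" if xy: "x \<in> V" "y \<in> V" "x \<noteq> y" for x y
    proof -
      have "covering_family s (k - 1 - 1) (V - {x} - {y})
          {i \<in> {i \<in> ?I. x \<in> B i}. y \<in> B i - {x}} (\<lambda>i. B i - {x} - {y})"
        using B xy unfolding s by (intro covering_family_derived) auto
      moreover have "s \<le> k - 1 - 1" using tk s by simp
      moreover have "q * (k - 1 - 1) < card (V - {x} - {y})"
      proof -
        have "finite V" using B by (simp add: covering_family_def)
        then have "card (V - {x} - {y}) = v - 2" using xy cV by simp
        moreover have "q * (k - 2) + 2 * q = q * k" using tk t by (simp add: diff_mult_distrib2)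
        ultimately show ?thesis using v by (simp add: numeral_2_eq_2)
      qed
      ultimately have "(\<Sum>i<Suc s. q ^ i) \<le> card {i \<in> {i \<in> ?I. x \<in> B i}. y \<in> B i - {x}}"
        by (rule covering_family_size_ge) (use q in simp)
      also have "{i \<in> {i \<in> ?I. x \<in> B i}. y \<in> B i - {x}} = {i \<in> ?I. x \<in> B i \<and> y \<in> B i}"
        using xy by auto
      finally show ?thesis by (simp add: lam s)
    qed
  qed
  then show ?thesis by simp
qed

text \<open>An upper bound may be proved with sets that are too small or that leave \<open>V\<close>: they are cut
  down to \<open>V\<close> and then filled up to size \<open>k\<close>, which only covers more.\<close>

lemma covering_number_le_card_family:
  fixes V :: "'a set"
  assumes fin: "finite V" "finite \<A>" and pars: "0 < t" "t \<le> k" "k \<le> card V"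
    and small: "\<And>A. A \<in> \<A> \<Longrightarrow> card (A \<inter> V) \<le> k"
    and cov: "\<And>T. T \<subseteq> V \<Longrightarrow> card T = t \<Longrightarrow> \<exists>A\<in>\<A>. T \<subseteq> A"
  shows "covering_number (card V) k t \<le> card \<A>"
proof -
  have "\<exists>E. A \<inter> V \<subseteq> E \<and> E \<subseteq> V \<and> card E = k" if "A \<in> \<A>" for A
    using exists_subset_between[of "A \<inter> V" k V] small[OF that] pars(3) fin(1) by auto
  then obtain E where E: "\<And>A. A \<in> \<A> \<Longrightarrow> A \<inter> V \<subseteq> E A \<and> E A \<subseteq> V \<and> card (E A) = k"
    by metis
  have "covering t (card V) k V (image_mset E (mset_set \<A>))"
    unfolding covering_def
  proof (intro conjI ballI allI impI)
    fix T assume T: "T \<subseteq> V \<and> card T = t"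
    then obtain A where "A \<in> \<A>" "T \<subseteq> A" using cov by blast
    then show "\<exists>B\<in>#image_mset E (mset_set \<A>). T \<subseteq> B"
      using E[of A] T fin(2) by auto
  qed (use fin pars E in auto)
  from covering_number_le[OF this] show ?thesis by simp
qed

lemma covering_number_le_hyperplanes:
  assumes "primepow q" and pars: "0 < t" "t \<le> m * q ^ (t - 1)" "m * q ^ (t - 1) \<le> v" "v \<le> m * q ^ t"
  shows "covering_number v (m * q ^ (t - 1)) t * (q - 1) \<le> q * (q ^ t - 1)"
proof -
  obtain p n where pn: "prime p" "0 < n" "q = p ^ n" using assms(1) by (auto simp: primepow_def)
  obtain F :: "(((int list \<times> nat) multiset) \<Rightarrow> int) ring" where F: "field F" "card (carrier F) = q"
    using finite_field_exists[OF pn(1,2)] pn(3) by metis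
  have "0 < q" using pn by (simp add: prime_gt_0_nat)
  then have finF: "finite (carrier F)" using F(2) by (intro card_ge_0_finite) simp
  define V where "V = {..<t} \<rightarrow>\<^sub>E carrier F"
  obtain \<H> where H: "finite \<H>" "card \<H> * (q - 1) \<le> q * (q ^ t - 1)"
    "\<And>H. H \<in> \<H> \<Longrightarrow> H \<subseteq> V \<and> card H \<le> q ^ (t - 1)"
    "\<And>S. S \<subseteq> V \<Longrightarrow> S \<noteq> {} \<Longrightarrow> card S \<le> t \<Longrightarrow> \<exists>H\<in>\<H>. S \<subseteq> H"
    using field.hyperplane_cover_exists[OF F(1) finF, of t] unfolding F(2) V_def by metis
  have finV: "finite V" and cV: "card V = q ^ t"
    using finF F(2) by (simp_all add: V_def finite_PiE card_PiE)
  have "v \<le> card (V \<times> {..<m})" using pars cV by (simp add: card_cartesian_product mult.commute)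
  then obtain U where U: "U \<subseteq> V \<times> {..<m}" "card U = v" "finite U"
    using obtain_subset_with_card_n by metis
  let ?\<A> = "(\<lambda>H. H \<times> {..<m}) ` \<H>"
  have "covering_number (card U) (m * q ^ (t - 1)) t \<le> card ?\<A>"
  proof (rule covering_number_le_card_family)
    show "finite U" "finite ?\<A>" "0 < t" "t \<le> m * q ^ (t - 1)" "m * q ^ (t - 1) \<le> card U"
      using U H(1) pars by auto
    show "card (A \<inter> U) \<le> m * q ^ (t - 1)" if A: "A \<in> ?\<A>" for A
    proof -
      obtain H where H': "A = H \<times> {..<m}" "H \<in> \<H>" using A by blast
      have "finite H" using H(3)[OF H'(2)] finV finite_subset by blast
      then have "card (A \<inter> U) \<le> card (H \<times> {..<m})" unfolding H'(1) by (intro card_mono) auto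
      also have "\<dots> \<le> m * q ^ (t - 1)" using H(3)[OF H'(2)] by (simp add: card_cartesian_product)
      finally show ?thesis .
    qed
    show "\<exists>A\<in>?\<A>. T \<subseteq> A" if T: "T \<subseteq> U" "card T = t" for T
    proof -
      have "finite T" "T \<noteq> {}" using T U \<open>0 < t\<close> finite_subset by auto
      moreover have TW: "T \<subseteq> V \<times> {..<m}" using T U by blast
      ultimately have "fst ` T \<subseteq> V" "fst ` T \<noteq> {}" "card (fst ` T) \<le> t"
        using card_image_le[of T fst] T(2) by auto
      then obtain H where H': "H \<in> \<H>" "fst ` T \<subseteq> H" using H(4) by blast
      from H'(2) TW have "T \<subseteq> H \<times> {..<m}" by force
      then show ?thesis using H'(1) by blast
    qed
  qed
  also have "\<dots> \<le> card \<H>" using H(1) by (rule card_image_le)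
  finally have "covering_number v (m * q ^ (t - 1)) t * (q - 1) \<le> card \<H> * (q - 1)"
    using U(2) by simp
  then show ?thesis by (rule le_trans[OF _ H(2)])
qed

theorem theorem10:
  fixes m q t v :: nat and z :: int
  assumes "0 < m" and "0 < q" and "0 < t"
    and "primepow q"
    and "2 * q + 2 \<le> m"
    and "2 \<le> t" and "t < m * q ^ (t - 1)"
    and "z = min (int q - 2)
               (\<lfloor>real m * (real q - 1) * real q ^ (t - 1) / (real q ^ t - 1)\<rfloor> - 2 * int q + 1)"
    and "int m * int q ^ t - int q + 1 - z \<le> int v"
    and "v \<le> m * q ^ t"
  shows "real (covering_number v (m * q ^ (t - 1)) t) = real q * ((real q ^ t - 1) / (real q - 1))"
proof -
  define k where "k = m * q ^ (t - 1)"
  define lam where "lam = (\<Sum>i<t - 1. q ^ i)"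
  define N where "N = (\<Sum>i<t. q ^ i)"
  define b where "b = covering_number v k t"
  have q: "2 \<le> q" using primepow_gt_Suc_0[OF assms(4)] by simp
  obtain s where s: "t = Suc s" using assms(3) gr0_implies_Suc by blast
  have N: "N = q * lam + 1"
    unfolding N_def lam_def s by (subst sum.lessThan_Suc_shift) (simp add: sum_distrib_left)
  have qk: "q * k = m * q ^ t" unfolding k_def s by simp
  have geom: "(int q - 1) * int N = int q ^ t - 1" "(int q - 1) * int lam = int q ^ (t - 1) - 1"
    unfolding N_def lam_def by (simp_all add: power_diff_1_eq)
  have k_ge: "q ^ (t - 1) \<le> k" "m \<le> k" using assms(1) q by (simp_all add: k_def)
  have z: "z \<le> int q - 2"
    "z \<le> \<lfloor>real m * (real q - 1) * real q ^ (t - 1) / (real q ^ t - 1)\<rfloor> - 2 * int q + 1"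
    using assms(8) by auto
  define d where "d = int (q * k) - int v"
  have d: "d \<le> int q - 1 + z" using assms(9) by (simp add: d_def qk)
  \<comment> \<open>Since \<open>q^t - 1 = (q - 1) N\<close>, the fraction under the floor equals \<open>k / N\<close>.\<close>
  have dN: "(d + int q) * int N \<le> int k"
  proof -
    have pos: "0 < real q ^ t - 1" using q assms(3) by (simp add: one_less_power)
    have "real_of_int (d + int q) \<le> real m * (real q - 1) * real q ^ (t - 1) / (real q ^ t - 1)"
      using d z(2) by linarith
    then have "real_of_int (d + int q) * (real q ^ t - 1) \<le> real m * (real q - 1) * real q ^ (t - 1)"
      using pos by (simp add: pos_le_divide_eq)
    also have "real q ^ t - 1 = real_of_int ((int q - 1) * int N)" unfolding geom by simp
    finally have "real_of_int ((int q - 1) * ((d + int q) * int N)) \<le> real_of_int ((int q - 1) * int k)"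
      by (simp add: k_def mult_ac)
    then have "(int q - 1) * ((d + int q) * int N) \<le> (int q - 1) * int k" by (simp only: of_int_le_iff)
    then show ?thesis using q by simp
  qed
  have v: "int q * int k + 3 \<le> int v + 2 * int q" using d z(1) by (simp add: d_def)
  have "k \<le> v"
  proof -
    have "2 * int k \<le> int q * int k" using q by (intro mult_right_mono) auto
    then show ?thesis using v k_ge(2) assms(5) by linarith
  qed
  have "int q * int lam < int k + int lam"
    using geom(2) k_ge(1) by (simp add: algebra_simps flip: of_nat_power)
  then have k_gt: "q * lam < k + lam" by (simp flip: of_nat_mult of_nat_add)
  obtain V :: "nat set" and \<B> where cov: "covering t v k V \<B>" "size \<B> = b"
    using covering_number_attained[OF assms(3), of k v] assms(7) \<open>k \<le> v\<close> unfolding b_def k_def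
    by auto
  have "q * k + 2 < v + 2 * q" using v by (simp flip: of_nat_mult)
  from t_covering_size_bound[OF cov(1) assms(6) q lam_def this k_gt]
  have "int v * int N \<le> int b * (int k + 1)"
    unfolding cov(2) N[symmetric] by (metis of_nat_1 of_nat_add of_nat_le_iff of_nat_mult)
  then have low: "(int q * int k - d) * int N \<le> int b * (int k + 1)" by (simp add: d_def)
  have "q * N \<le> b"
  proof (rule ccontr)
    assume "\<not> q * N \<le> b"
    then have "int b \<le> int q * int N - 1" by (simp flip: of_nat_mult)
    then have "int b * (int k + 1) \<le> (int q * int N - 1) * (int k + 1)" by (intro mult_right_mono) auto
    with low dN show False by (simp add: algebra_simps)
  qed
  moreover have "b \<le> q * N"
  proof -
    have "b * (q - 1) \<le> q * (q ^ t - 1)"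
      unfolding b_def k_def using assms(3,4,7,10) \<open>k \<le> v\<close>
      by (intro covering_number_le_hyperplanes) (auto simp: k_def)
    also have "q ^ t - 1 = (q - 1) * N"
    proof -
      have "int (q ^ t - 1) = int ((q - 1) * N)" using geom(1) q by (simp add: of_nat_diff)
      then show ?thesis by (simp only: of_nat_eq_iff)
    qed
    finally have "b * (q - 1) \<le> (q * N) * (q - 1)" by (simp only: ac_simps)
    then show ?thesis using q by simp
  qed
  ultimately have "b = q * N" by simp
  moreover have "real N = (real q ^ t - 1) / (real q - 1)"
    using q unfolding N_def by (simp add: geometric_sum)
  ultimately show ?thesis by (simp add: b_def k_def)
qed


end
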